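(* Let $D\subseteq\mathbb{C}$ be a domain and let $\mathcal{F}$ be a family of holomorphic functions on $D$ such that the Julia like set $J(\mathcal{F})$ has an isolated point. Then the generalized escaping like set $U(\mathcal{F})$ is non-empty.
   Context: A family $\mathcal{F}$ of holomorphic functions is normal on an open set if every sequence in $\mathcal{F}$ has a subsequence that converges locally uniformly on that open set either to a holomorphic function or to $\infty$; it is normal at a point if it is normal on some neighborhood of that point. For a family $\mathcal{F}$ of holomorphic functions on a domain $D\subseteq\mathbb{C}$, the Fatou like set $F(\mathcal{F})\subseteq D$ is the set of points of $D$ at which $\mathcal{F}$ is normal, and the Julia like set is $J(\mathcal{F}):=D\setminus F(\mathcal{F})$. The generalized escaping like set is $U(\mathcal{F}):=\{z\in D: f_n(z)\to\infty \text{ for some sequence } \{f_n\}\text{ in }\mathcal{F}\}$. *)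

theory Defs
  imports "HOL-Complex_Analysis.Complex_Analysis"
begin

definition locally_uniform_limit ::
    "complex set \<Rightarrow> (nat \<Rightarrow> complex \<Rightarrow> complex) \<Rightarrow> (complex \<Rightarrow> complex) \<Rightarrow> bool" where
  "locally_uniform_limit V f g \<longleftrightarrow>
     (\<forall>z\<in>V. \<exists>W. open W \<and> z \<in> W \<and> W \<subseteq> V \<and> uniform_limit W f g sequentially)"

definition locally_uniform_to_infinity ::
    "complex set \<Rightarrow> (nat \<Rightarrow> complex \<Rightarrow> complex) \<Rightarrow> bool" where
  "locally_uniform_to_infinity V f \<longleftrightarrow>
     (\<forall>z\<in>V. \<exists>W. open W \<and> z \<in> W \<and> W \<subseteq> V \<and>
        (\<forall>B::real. \<forall>\<^sub>F n in sequentially. \<forall>w\<in>W. B < norm (f n w)))"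

text \<open>The same alternative (holomorphic limit or infinity) has to hold on all of the open set.\<close>

definition normal_on :: "(complex \<Rightarrow> complex) set \<Rightarrow> complex set \<Rightarrow> bool" where
  "normal_on \<F> V \<longleftrightarrow>
     (\<forall>f :: nat \<Rightarrow> complex \<Rightarrow> complex. range f \<subseteq> \<F> \<longrightarrow>
        (\<exists>r :: nat \<Rightarrow> nat. strict_mono r \<and>
           ((\<exists>g. g holomorphic_on V \<and> locally_uniform_limit V (f \<circ> r) g) \<or>
            locally_uniform_to_infinity V (f \<circ> r))))"

text \<open>In what follows the members of the family are total functions of which only the values on
  the domain \<open>D\<close> are meaningful; hence neighbourhoods are required to lie inside \<open>D\<close>.\<close>

definition Fatou_like :: "complex set \<Rightarrow> (complex \<Rightarrow> complex) set \<Rightarrow> complex set" where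
  "Fatou_like D \<F> = {z \<in> D. \<exists>V. open V \<and> z \<in> V \<and> V \<subseteq> D \<and> normal_on \<F> V}"

definition Julia_like :: "complex set \<Rightarrow> (complex \<Rightarrow> complex) set \<Rightarrow> complex set" where
  "Julia_like D \<F> = D - Fatou_like D \<F>"

text \<open>A sequence in the family may repeat members.\<close>

definition gen_escaping_like :: "complex set \<Rightarrow> (complex \<Rightarrow> complex) set \<Rightarrow> complex set" where
  "gen_escaping_like D \<F> =
     {z \<in> D. \<exists>f :: nat \<Rightarrow> complex \<Rightarrow> complex. range f \<subseteq> \<F> \<and>
        filterlim (\<lambda>n. f n z) at_infinity sequentially}"

end

theory Submission
  imports Defs
begin

text \<open>
  If no point escapes, the family is pointwise bounded. At a point of normality, pointwise
  boundedness excludes the limit \<open>\<infinity>\<close>, so the family is locally bounded there. An isolated point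
  of the Julia like set is encircled by points of normality, so the family is bounded on a small
  circle and, by the maximum principle, on the disc inside; Montel's theorem then makes the
  family normal at the centre, a contradiction.
\<close>

text \<open>Each term of a sequence may be picked freely from the family, so choosing the term of
  index \<open>n\<close> with modulus above \<open>n\<close> at \<open>z\<close> already forces
  divergence there. This turns the assumption that no point escapes into pointwise boundedness, the
  form used from here on.\<close>

lemma gen_escaping_like_iff_unbounded:
  "z \<in> gen_escaping_like D \<F> \<longleftrightarrow> z \<in> D \<and> \<not> bounded ((\<lambda>f. f z) ` \<F>)"
proof (intro iffI conjI)
  assume "z \<in> gen_escaping_like D \<F>"
  then obtain f where "z \<in> D" and f: "range f \<subseteq> \<F>" "filterlim (\<lambda>n. f n z) at_infinity sequentially"
    unfolding gen_escaping_like_def by blast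
  then show "z \<in> D" by simp
  show "\<not> bounded ((\<lambda>f. f z) ` \<F>)"
  proof
    assume "bounded ((\<lambda>f. f z) ` \<F>)"
    then obtain B where B: "\<And>f. f \<in> \<F> \<Longrightarrow> norm (f z) \<le> B"
      by (auto simp: bounded_iff)
    have "filterlim (\<lambda>n. norm (f n z)) at_top sequentially"
      using f(2) by (rule filterlim_at_infinity_imp_norm_at_top)
    then have "\<forall>\<^sub>F n in sequentially. B < norm (f n z)"
      by (simp add: filterlim_at_top_dense)
    then obtain n where "B < norm (f n z)"
      by (auto simp: eventually_sequentially)
    with B[of "f n"] f(1) show False by auto
  qed
next
  assume z: "z \<in> D \<and> \<not> bounded ((\<lambda>f. f z) ` \<F>)"
  then have "\<exists>f\<in>\<F>. real n < norm (f z)" for n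
    by (auto simp: bounded_iff not_le)
  then obtain f where f: "\<And>n. f n \<in> \<F>" "\<And>n. real n < norm (f n z)"
    by metis
  have "filterlim (\<lambda>n. norm (f n z)) at_top sequentially"
    by (rule filterlim_at_top_mono[OF filterlim_real_sequentially always_eventually])
      (use f(2) less_imp_le in blast)
  then have "filterlim (\<lambda>n. f n z) at_infinity sequentially"
    by (rule filterlim_norm_at_top_imp_at_infinity)
  with z f(1) show "z \<in> gen_escaping_like D \<F>"
    unfolding gen_escaping_like_def by blast
qed

text \<open>Were there no common bound near \<open>w\<close>, some members \<open>f n\<close> would
  exceed \<open>n\<close> at points \<open>u n\<close> tending to \<open>w\<close>. Normality
  provides a subsequence; its divergence contradicts the bound at \<open>w\<close>, and a finite
  limit \<open>g\<close> keeps the values at \<open>u (r n)\<close> close to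
  \<open>g w\<close>.\<close>

lemma locally_bounded_if_Fatou_like:
  assumes w: "w \<in> Fatou_like D \<F>" and bdd: "bounded ((\<lambda>f. f w) ` \<F>)"
  obtains e B where "e > 0" "\<And>f z. f \<in> \<F> \<Longrightarrow> z \<in> ball w e \<Longrightarrow> norm (f z) \<le> B"
proof (rule ccontr)
  assume "\<not> thesis"
  with that have "\<exists>f\<in>\<F>. \<exists>z\<in>ball w e. B < norm (f z)" if "e > 0" for e B
    using \<open>e > 0\<close> by (meson not_le)
  \<comment> \<open>The radius uses \<open>Suc n\<close> so that it is positive at
    \<open>n = 0\<close> too; radii shrink while the bounds grow.\<close>
  then have "\<exists>f\<in>\<F>. \<exists>z\<in>ball w (inverse (real (Suc n))). real n < norm (f z)" for n
    by simp
  then obtain f u where f: "\<And>n. f n \<in> \<F>"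
    and u: "\<And>n. u n \<in> ball w (inverse (real (Suc n)))" and fu: "\<And>n. real n < norm (f n (u n))"
    by metis
  obtain V where V: "open V" "w \<in> V" "normal_on \<F> V"
    using w unfolding Fatou_like_def by blast
  obtain r where r: "strict_mono r" and alt:
    "(\<exists>g. g holomorphic_on V \<and> locally_uniform_limit V (f \<circ> r) g) \<or>
      locally_uniform_to_infinity V (f \<circ> r)"
    using V(3)[unfolded normal_on_def, rule_format, of f] f by blast
  have "(\<lambda>n. dist (u n) w) \<longlonglongrightarrow> 0"
    by (rule tendsto_sandwich[OF _ _ tendsto_const LIMSEQ_inverse_real_of_nat])
      (use u in \<open>auto simp: dist_commute intro!: always_eventually less_imp_le\<close>)
  then have "u \<longlonglongrightarrow> w"
    by (rule tendsto_dist_iff[THEN iffD2])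
  then have ur: "(u \<circ> r) \<longlonglongrightarrow> w"
    using r by (rule LIMSEQ_subseq_LIMSEQ)
  from alt show False
  proof
    assume "locally_uniform_to_infinity V (f \<circ> r)"
    \<comment> \<open>Divergence is evaluated at the centre \<open>w\<close>, where the family is
      bounded by assumption.\<close>
    then have ev: "\<forall>\<^sub>F n in sequentially. B < norm (f (r n) w)" for B
      using V(2) unfolding locally_uniform_to_infinity_def
      by (fastforce elim!: eventually_mono)
    obtain B where "\<And>f. f \<in> \<F> \<Longrightarrow> norm (f w) \<le> B"
      using bdd by (auto simp: bounded_iff)
    with f ev[of B] show False
      by (auto simp: eventually_sequentially not_less[symmetric])
  next
    assume "\<exists>g. g holomorphic_on V \<and> locally_uniform_limit V (f \<circ> r) g"
    then obtain g W where g: "g holomorphic_on V" and W: "open W" "w \<in> W"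
      and lim: "uniform_limit W (f \<circ> r) g sequentially"
      using V(2) unfolding locally_uniform_limit_def by blast
    have "isCont g w"
      using g V holomorphic_on_imp_continuous_on continuous_on_eq_continuous_at by blast
    then have "(\<lambda>n. norm (g ((u \<circ> r) n))) \<longlonglongrightarrow> norm (g w)"
      using ur by (intro tendsto_norm) (rule isCont_tendsto_compose)
    then have "\<forall>\<^sub>F n in sequentially. norm (g (u (r n))) < norm (g w) + 1"
      by (auto dest!: order_tendstoD(2)[where a = "norm (g w) + 1"])
    moreover have "\<forall>\<^sub>F n in sequentially. u (r n) \<in> W"
      using topological_tendstoD[OF ur W] by simp
    moreover have "\<forall>\<^sub>F n in sequentially. \<forall>z\<in>W. dist (f (r n) z) (g z) < 1"
      using uniform_limitD[OF lim, of 1] by simp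
    \<comment> \<open>The slack 2 is 1 from continuity of \<open>g\<close> at \<open>w\<close> plus
      1 from uniform closeness to \<open>g\<close>. With \<open>n \<le> r n\<close> it contradicts
      \<open>r n < norm (f (r n) (u (r n)))\<close>.\<close>
    moreover have "\<forall>\<^sub>F n in sequentially. norm (g w) + 2 \<le> real n"
      using filterlim_real_sequentially by (rule filterlim_at_top[THEN iffD1, rule_format])
    ultimately have "\<forall>\<^sub>F n::nat in sequentially. False"
    proof eventually_elim
      case (elim n)
      then have "dist (f (r n) (u (r n))) (g (u (r n))) < 1" by blast
      then have "norm (f (r n) (u (r n))) < norm (g (u (r n))) + 1"
        using norm_triangle_ineq2[of "f (r n) (u (r n))" "g (u (r n))"] by (simp add: dist_norm)
      moreover have "real n \<le> real (r n)"
        using seq_suble[OF r] by simp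
      ultimately show False
        using elim fu[of "r n"] by linarith
    qed
    then show False by simp
  qed
qed

text \<open>Finitely many of the balls carrying a local bound cover \<open>K\<close>, and the
  largest of their bounds serves the whole family.\<close>

lemma bounded_on_compact_subset_Fatou_like:
  assumes K: "compact K" "K \<subseteq> Fatou_like D \<F>"
    and bdd: "\<And>w. w \<in> K \<Longrightarrow> bounded ((\<lambda>f. f w) ` \<F>)"
  obtains B where "\<And>f z. f \<in> \<F> \<Longrightarrow> z \<in> K \<Longrightarrow> norm (f z) \<le> B"
proof -
  have "\<exists>e B. e > 0 \<and> (\<forall>f\<in>\<F>. \<forall>z\<in>ball w e. norm (f z) \<le> B)" if "w \<in> K" for w
    by (rule locally_bounded_if_Fatou_like[of w D \<F>]) (use that K bdd in blast)+
  then obtain e B where e: "\<And>w. w \<in> K \<Longrightarrow> e w > 0"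
    and B: "\<And>w f z. w \<in> K \<Longrightarrow> f \<in> \<F> \<Longrightarrow> z \<in> ball w (e w) \<Longrightarrow> norm (f z) \<le> B w"
    by metis
  have "K \<subseteq> (\<Union>w\<in>K. ball w (e w))"
    using e by force
  then obtain C where C: "C \<subseteq> K" "finite C" "K \<subseteq> (\<Union>w\<in>C. ball w (e w))"
    using compactE_image[OF K(1), of K "\<lambda>w. ball w (e w)"] by auto
  \<comment> \<open>For empty \<open>K\<close> the set \<open>C\<close> is empty and the maximum
    unspecified, but then there is no \<open>z\<close> to consider.\<close>
  have "norm (f z) \<le> Max (B ` C)" if f: "f \<in> \<F>" and z: "z \<in> K" for f z
  proof -
    obtain w where "w \<in> C" "z \<in> ball w (e w)"
      using C(3) z by blast
    moreover from this have "norm (f z) \<le> B w"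
      using B C(1) f by blast
    ultimately show ?thesis
      using C(2) by (meson Max_ge finite_imageI image_eqI order_trans)
  qed
  then show thesis
    by (rule that)
qed

text \<open>Montel's theorem gives a subsequence converging uniformly on compact subsets of
  \<open>V\<close>; closed balls inside \<open>V\<close> turn this into uniform convergence on a
  neighbourhood of each point, so the holomorphic alternative always occurs.\<close>

lemma normal_on_if_bounded:
  assumes V: "open V" and hol: "\<And>f. f \<in> \<F> \<Longrightarrow> f holomorphic_on V"
    and B: "\<And>f z. f \<in> \<F> \<Longrightarrow> z \<in> V \<Longrightarrow> norm (f z) \<le> B"
  shows "normal_on \<F> V"
  unfolding normal_on_def
proof (intro allI impI)
  fix f :: "nat \<Rightarrow> complex \<Rightarrow> complex"
  assume f: "range f \<subseteq> \<F>"
  obtain g r where g: "g holomorphic_on V" and r: "strict_mono r"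
    and lim: "\<And>K. compact K \<Longrightarrow> K \<subseteq> V \<Longrightarrow> uniform_limit K (f \<circ> r) g sequentially"
  proof (rule Montel[of V \<F> f])
    show "\<exists>B. \<forall>h\<in>\<F>. \<forall>z\<in>K. norm (h z) \<le> B" if "compact K" "K \<subseteq> V" for K
      using B that by blast
  qed (use V hol f in auto)
  have "\<exists>W. open W \<and> z \<in> W \<and> W \<subseteq> V \<and> uniform_limit W (f \<circ> r) g sequentially" if z: "z \<in> V" for z
  proof -
    obtain e where e: "e > 0" "cball z e \<subseteq> V"
      using V z open_contains_cball by blast
    then have "uniform_limit (ball z e) (f \<circ> r) g sequentially"
      using lim[of "cball z e"] by (auto intro: uniform_limit_on_subset)
    with e show ?thesis
      by (intro exI[of _ "ball z e"]) auto
  qed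
  with g r show "\<exists>r. strict_mono r \<and>
      ((\<exists>g. g holomorphic_on V \<and> locally_uniform_limit V (f \<circ> r) g) \<or>
        locally_uniform_to_infinity V (f \<circ> r))"
    unfolding locally_uniform_limit_def by blast
qed

theorem theorem3p11:
  fixes D :: "complex set" and \<F> :: "(complex \<Rightarrow> complex) set"
  assumes "open D" and "connected D" and "D \<noteq> {}"
    and "\<And>f. f \<in> \<F> \<Longrightarrow> f holomorphic_on D"
    and "\<exists>z0. z0 isolated_in (Julia_like D \<F>)"
  shows "gen_escaping_like D \<F> \<noteq> {}"
proof
  assume "gen_escaping_like D \<F> = {}"
  then have bdd: "bounded ((\<lambda>f. f z) ` \<F>)" if "z \<in> D" for z
    using that gen_escaping_like_iff_unbounded by blast
  obtain z0 T where z0: "z0 \<in> Julia_like D \<F>" and T: "open T" "T \<inter> Julia_like D \<F> = {z0}"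
    using assms(5) unfolding isolated_in_def by blast
  have "open (D \<inter> T)" "z0 \<in> D \<inter> T"
    using assms(1) z0 T by (auto simp: Julia_like_def)
  \<comment> \<open>A closed disc is taken so that its boundary circle also lies in \<open>D\<close>
    and in \<open>T\<close>, where \<open>z0\<close> is the only Julia point.\<close>
  then obtain \<rho> where \<rho>: "\<rho> > 0" and sub: "cball z0 \<rho> \<subseteq> D \<inter> T"
    using open_contains_cball by blast
  have "sphere z0 \<rho> \<subseteq> Fatou_like D \<F>"
  proof
    fix w assume "w \<in> sphere z0 \<rho>"
    with \<rho> sub have "w \<in> D" "w \<in> T" "w \<noteq> z0"
      by (auto simp: subset_iff)
    with T show "w \<in> Fatou_like D \<F>"
      unfolding Julia_like_def by blast
  qed
  moreover have "bounded ((\<lambda>f. f w) ` \<F>)" if "w \<in> sphere z0 \<rho>" for w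
    using that sub bdd[of w] by auto
  ultimately obtain B where B: "\<And>f z. f \<in> \<F> \<Longrightarrow> z \<in> sphere z0 \<rho> \<Longrightarrow> norm (f z) \<le> B"
    using bounded_on_compact_subset_Fatou_like[OF compact_sphere] by metis
  \<comment> \<open>The maximum principle carries the bound from the circle into the disc with the
    same \<open>B\<close> for every member, across the centre \<open>z0\<close>, where normality is
    not yet known.\<close>
  have "norm (f z) \<le> B" if f: "f \<in> \<F>" and z: "z \<in> ball z0 \<rho>" for f z
  proof (rule maximum_modulus_frontier[of f "ball z0 \<rho>"])
    have hol: "f holomorphic_on cball z0 \<rho>"
      using assms(4)[OF f] by (rule holomorphic_on_subset) (use sub in blast)
    then show "f holomorphic_on interior (ball z0 \<rho>)"
      by (rule holomorphic_on_subset) auto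
    show "continuous_on (closure (ball z0 \<rho>)) f"
      using hol \<rho> by (simp add: holomorphic_on_imp_continuous_on)
    show "norm (f w) \<le> B" if "w \<in> frontier (ball z0 \<rho>)" for w
      using B[OF f] that \<rho> by simp
  qed (use z in auto)
  moreover have "f holomorphic_on ball z0 \<rho>" if "f \<in> \<F>" for f
    using assms(4)[OF that] by (rule holomorphic_on_subset) (use sub ball_subset_cball in blast)
  ultimately have "normal_on \<F> (ball z0 \<rho>)"
    by (intro normal_on_if_bounded) auto
  moreover have "ball z0 \<rho> \<subseteq> D"
    using sub by auto
  ultimately have "z0 \<in> Fatou_like D \<F>"
    using \<rho> z0 unfolding Fatou_like_def Julia_like_def
    by (auto intro!: exI[of _ "ball z0 \<rho>"])
  with z0 show False
    by (simp add: Julia_like_def)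
qed

end
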